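(* Let the fresh arrival rate be a constant $r$. Suppose the system is saturated, $N_t\ge mk$, and the fleet switches to tier $j$. The queue drains back below $mk$ if and only if $r<\theta_j$, where $\theta_j=(1-d_j\rho)\,k\mu_j m$ is the tier's effective throughput. Above this threshold ($r>\theta_j$) the retry feedback is self-sustaining: the drift of $N$ is positive, $N$ never returns below $mk$, and the backlog and the churn ledger grow without bound.
   Context: A fleet of $k$ servers with $m$ concurrent slots each has capacity $mk$ jobs; $N_t$ is the number of jobs resident in the system at time $t$. Serving at quality tier $j$, each busy slot completes jobs at rate $\mu_j=1/\mathbf{E}[S_j]$, where $\mathbf{E}[S_j]$ is the mean service time. A completed answer fails its user with probability $d_j\in[0,1)$. An unsatisfied user re-asks with probability $\rho$, in which case the query instantaneously re-enters the arrival stream (a retry), and abandons with probability $1-\rho$. Each abandonment books the expected lifetime-value loss $p_r\ell$ on the churn ledger, where $p_r$ is the probability that an abandoning customer churns and $\ell$ is the expected lifetime margin of a customer. The churn ledger is the cumulative total of these charges. The effective throughput of tier $j$ is $\theta_j=(1-d_j\rho)k\mu_j m$ and its effective service rate is $\mu^{\mathrm{eff}}_j=(1-d_j\rho)\mu_j$. The backlog follows, in expectation, the two-regime dynamics with retries included: while $N_t\ge mk$, $N_{t+\Delta t}=N_t+(r-\theta_j)\Delta t$; while $N_t<mk$, $N_{t+\Delta t}=N_te^{-\mu^{\mathrm{eff}}_j\Delta t}+\frac{r}{\mu^{\mathrm{eff}}_j}\bigl(1-e^{-\mu^{\mathrm{eff}}_j\Delta t}\bigr)$. The fleet stays on tier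 $j$ after the switch.
   Formalization: Unbounded growth of the churn ledger is claimed only when d_j > 0, ρ < 1 and p_r ℓ > 0 (otherwise no abandonment is ever charged and the ledger stays constant); the expected backlog N is taken to be continuous in time. *)

theory Defs
  imports "HOL-Probability.Probability"
begin

text \<open>
  Parameters: \<open>k\<close> servers with \<open>m\<close> slots each, per-slot service rate \<open>\<mu>\<close>, failure probability \<open>d\<close>,
  retry probability \<open>\<rho>\<close>, fresh arrival rate \<open>r\<close>. Time is continuous and \<open>N t\<close> is the (expected)
  number of jobs in the system at time \<open>t\<close>.
\<close>

definition effective_throughput :: "nat \<Rightarrow> nat \<Rightarrow> real \<Rightarrow> real \<Rightarrow> real \<Rightarrow> real" where
  "effective_throughput k m d \<rho> \<mu> = (1 - d * \<rho>) * real k * \<mu> * real m"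

definition effective_service_rate :: "real \<Rightarrow> real \<Rightarrow> real \<Rightarrow> real" where
  "effective_service_rate d \<rho> \<mu> = (1 - d * \<rho>) * \<mu>"

text \<open>
  Each regime's increment formula applies over \<open>\<Delta>\<close> time units provided that the regime persists
  during \<open>[t, t + \<Delta>)\<close>. (Requiring only \<open>N t \<ge> m k\<close> at the left end point, for arbitrary \<open>\<Delta>\<close>, would
  make the two rules contradict each other as soon as \<open>N\<close> changes regime.)
\<close>

definition two_regime_dynamics ::
  "nat \<Rightarrow> nat \<Rightarrow> real \<Rightarrow> real \<Rightarrow> real \<Rightarrow> real \<Rightarrow> real \<Rightarrow> (real \<Rightarrow> real) \<Rightarrow> bool" where
  "two_regime_dynamics k m d \<rho> \<mu> r t\<^sub>0 N \<longleftrightarrow>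
    (\<forall>t\<ge>t\<^sub>0. \<forall>\<Delta>\<ge>0. (\<forall>s\<in>{t..<t + \<Delta>}. N s \<ge> real (m * k)) \<longrightarrow>
      N (t + \<Delta>) = N t + (r - effective_throughput k m d \<rho> \<mu>) * \<Delta>) \<and>
    (\<forall>t\<ge>t\<^sub>0. \<forall>\<Delta>\<ge>0. (\<forall>s\<in>{t..<t + \<Delta>}. N s < real (m * k)) \<longrightarrow>
      N (t + \<Delta>) = N t * exp (- effective_service_rate d \<rho> \<mu> * \<Delta>)
        + r / effective_service_rate d \<rho> \<mu> * (1 - exp (- effective_service_rate d \<rho> \<mu> * \<Delta>)))"

text \<open>
  With \<open>n\<close> jobs in the system \<open>min n (m k)\<close> slots are busy, each completing jobs at rate \<open>\<mu>\<close>; a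
  completion fails its user with probability \<open>d\<close>, and an unsatisfied user abandons with
  probability \<open>1 - \<rho>\<close>.
\<close>

definition abandonment_rate :: "nat \<Rightarrow> nat \<Rightarrow> real \<Rightarrow> real \<Rightarrow> real \<Rightarrow> real \<Rightarrow> real" where
  "abandonment_rate k m d \<rho> \<mu> n = (1 - \<rho>) * (d * (\<mu> * min n (real (m * k))))"

text \<open>
  \<open>L\<^sub>0\<close> is the balance of the churn ledger at the switching time \<open>t\<^sub>0\<close>, and \<open>c\<close> is the charge booked
  per abandonment.
\<close>

definition churn_ledger ::
  "nat \<Rightarrow> nat \<Rightarrow> real \<Rightarrow> real \<Rightarrow> real \<Rightarrow> real \<Rightarrow> real \<Rightarrow> real \<Rightarrow> (real \<Rightarrow> real) \<Rightarrow> real \<Rightarrow> real" where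
  "churn_ledger k m d \<rho> \<mu> c L\<^sub>0 t\<^sub>0 N t =
    L\<^sub>0 + integral {t\<^sub>0..t} (\<lambda>s. c * abandonment_rate k m d \<rho> \<mu> (N s))"

end

theory Submission
  imports Defs
begin

text \<open>
  With \<open>K = m k\<close> and \<open>a\<close> the effective service rate, the effective throughput is \<open>\<theta> = a K\<close>, so
  the equilibrium level \<open>r / a\<close> of the unsaturated regime lies at or above \<open>K\<close> exactly when
  \<open>r \<ge> \<theta>\<close>. This one comparison decides everything.

  If \<open>r < \<theta>\<close>, a backlog that stayed at or above \<open>K\<close> forever would decrease linearly without
  bound, which is absurd (\<open>drains_if_arrival_below_throughput\<close>).

  If \<open>r \<ge> \<theta>\<close>, then below \<open>K\<close> the backlog relaxes exponentially towards an equilibrium at or above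
  \<open>K\<close>, hence never decreases there. A descent below \<open>K\<close> would have to be continuous and to start
  from the last instant at which the backlog is at least \<open>K\<close>, so it would pass downwards through
  values smaller than \<open>K\<close>, which is impossible (\<open>stays_saturated\<close>). The saturated regime thus lasts
  forever and \<open>N\<close> is affine with slope \<open>r - \<theta>\<close>. For \<open>r > \<theta>\<close> that slope is positive; and since all
  slots stay busy, abandonments occur at a constant rate, so the ledger is affine as well.
\<close>

lemma effective_throughput_eq_rate_times_capacity:
  "effective_throughput k m d \<rho> \<mu> = effective_service_rate d \<rho> \<mu> * real (m * k)"
  by (simp add: effective_throughput_def effective_service_rate_def)

lemma effective_service_rate_pos:
  assumes "0 \<le> d" "d < 1" "0 \<le> \<rho>" "\<rho> \<le> 1" "0 < \<mu>"
  shows "0 < effective_service_rate d \<rho> \<mu>"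
proof -
  have "d * \<rho> \<le> d"
    using assms by (simp add: mult_left_le)
  then show ?thesis
    using assms by (simp add: effective_service_rate_def)
qed

lemma saturated_backlog_affine:
  assumes dyn: "two_regime_dynamics k m d \<rho> \<mu> r t\<^sub>0 N"
    and sat: "\<And>t. t\<^sub>0 \<le> t \<Longrightarrow> real (m * k) \<le> N t"
    and "t\<^sub>0 \<le> t"
  shows "N t = N t\<^sub>0 + (r - effective_throughput k m d \<rho> \<mu>) * (t - t\<^sub>0)"
proof -
  have "\<forall>s\<in>{t\<^sub>0..<t\<^sub>0 + (t - t\<^sub>0)}. real (m * k) \<le> N s"
    using sat by simp
  moreover have "0 \<le> t - t\<^sub>0"
    using \<open>t\<^sub>0 \<le> t\<close> by simp
  ultimately have
    "N (t\<^sub>0 + (t - t\<^sub>0)) = N t\<^sub>0 + (r - effective_throughput k m d \<rho> \<mu>) * (t - t\<^sub>0)"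
    using dyn unfolding two_regime_dynamics_def by blast
  then show ?thesis
    by simp
qed

lemma drains_if_arrival_below_throughput:
  assumes dyn: "two_regime_dynamics k m d \<rho> \<mu> r t\<^sub>0 N"
    and "r < effective_throughput k m d \<rho> \<mu>"
  shows "\<exists>t\<ge>t\<^sub>0. N t < real (m * k)"
proof (rule ccontr)
  assume "\<not> ?thesis"
  then have sat: "real (m * k) \<le> N t" if "t\<^sub>0 \<le> t" for t
    using that by (simp add: not_less)
  define \<delta> where "\<delta> = effective_throughput k m d \<rho> \<mu> - r"
  have "0 < \<delta>"
    using assms by (simp add: \<delta>_def)
  \<comment> \<open>Draining at speed \<open>\<delta>\<close> would take the backlog to \<open>-1\<close> after \<open>(N t\<^sub>0 + 1) / \<delta>\<close> time units.\<close>
  define t where "t = t\<^sub>0 + (N t\<^sub>0 + 1) / \<delta>"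
  have "0 \<le> N t\<^sub>0"
    using sat[of t\<^sub>0] of_nat_0_le_iff[of "m * k"] by linarith
  then have "t\<^sub>0 \<le> t"
    using \<open>0 < \<delta>\<close> by (simp add: t_def)
  have "N t = N t\<^sub>0 - \<delta> * (t - t\<^sub>0)"
    using saturated_backlog_affine[OF dyn sat \<open>t\<^sub>0 \<le> t\<close>] by (simp add: \<delta>_def algebra_simps)
  also have "\<dots> = -1"
    using \<open>0 < \<delta>\<close> by (simp add: t_def)
  finally have "N t = -1" .
  then show False
    using sat[OF \<open>t\<^sub>0 \<le> t\<close>] of_nat_0_le_iff[of "m * k"] by linarith
qed

text \<open>
  Over an unsaturated period \<open>[s, t)\<close> the value \<open>N t\<close> is a convex combination of \<open>N s\<close> and the
  equilibrium level \<open>r / a\<close>. As \<open>N s < m k \<le> r / a\<close>, the combination is at least \<open>N s\<close>.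
\<close>

lemma unsaturated_backlog_nondecreasing:
  assumes dyn: "two_regime_dynamics k m d \<rho> \<mu> r t\<^sub>0 N"
    and rate: "0 < effective_service_rate d \<rho> \<mu>"
    and arr: "effective_throughput k m d \<rho> \<mu> \<le> r"
    and "t\<^sub>0 \<le> s" "s < t"
    and below: "\<And>u. s \<le> u \<Longrightarrow> u < t \<Longrightarrow> N u < real (m * k)"
  shows "N s \<le> N t"
proof -
  define a where "a = effective_service_rate d \<rho> \<mu>"
  define e where "e = exp (- a * (t - s))"
  have "0 < a"
    using rate by (simp add: a_def)
  then have "e \<le> 1"
    using \<open>s < t\<close> by (simp add: e_def)
  have "real (m * k) \<le> r / a"
    using arr \<open>0 < a\<close>
    by (simp add: effective_throughput_eq_rate_times_capacity a_def field_simps)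
  moreover have "N s < real (m * k)"
    using below \<open>s < t\<close> by simp
  ultimately have "N s \<le> r / a"
    by linarith
  have "\<forall>u\<in>{s..<s + (t - s)}. N u < real (m * k)"
    using below by simp
  moreover have "0 \<le> t - s"
    using \<open>s < t\<close> by simp
  ultimately have "N (s + (t - s)) = N s * e + r / a * (1 - e)"
    using dyn \<open>t\<^sub>0 \<le> s\<close> unfolding two_regime_dynamics_def a_def e_def by blast
  then have "N t - N s = (r / a - N s) * (1 - e)"
    by (simp add: algebra_simps)
  also have "\<dots> \<ge> 0"
    using \<open>N s \<le> r / a\<close> \<open>e \<le> 1\<close> by simp
  finally show ?thesis
    by simp
qed

text \<open>
  No rule of the dynamics covers a period during which the regime changes, so a crossing of the
  threshold has to be excluded by continuity. After the last saturated instant \<open>s\<close> the backlog is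
  nondecreasing, and yet the intermediate value theorem makes it pass through the midpoint between
  \<open>N t\<close> and \<open>m k\<close> on the way down to \<open>N t\<close>.
\<close>

lemma stays_saturated:
  assumes dyn: "two_regime_dynamics k m d \<rho> \<mu> r t\<^sub>0 N"
    and rate: "0 < effective_service_rate d \<rho> \<mu>"
    and arr: "effective_throughput k m d \<rho> \<mu> \<le> r"
    and cont: "continuous_on {t\<^sub>0..} N"
    and init: "real (m * k) \<le> N t\<^sub>0"
    and "t\<^sub>0 \<le> t"
  shows "real (m * k) \<le> N t"
proof (rule ccontr)
  assume "\<not> ?thesis"
  then have low: "N t < real (m * k)"
    by simp
  define A where "A = {s \<in> {t\<^sub>0..t}. real (m * k) \<le> N s}"
  have cont': "continuous_on {t\<^sub>0..t} N"
    using cont by (rule continuous_on_subset) auto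
  then have "closed A"
    unfolding A_def by (intro continuous_on_closed_Collect_le continuous_on_const) auto
  moreover have "bounded A"
    by (rule bounded_subset[of "{t\<^sub>0..t}"]) (auto simp: A_def)
  moreover have "A \<noteq> {}"
    using init \<open>t\<^sub>0 \<le> t\<close> by (auto simp: A_def)
  ultimately obtain s where "s \<in> A" and last: "\<And>u. u \<in> A \<Longrightarrow> u \<le> s"
    by (metis compact_attains_sup compact_eq_bounded_closed)
  then have s: "t\<^sub>0 \<le> s" "s \<le> t" "real (m * k) \<le> N s"
    by (auto simp: A_def)
  define y where "y = (N t + real (m * k)) / 2"
  have y: "N t < y" "y < real (m * k)"
    using low by (simp_all add: y_def del: of_nat_mult)
  have "continuous_on {s..t} N"
    using cont' by (rule continuous_on_subset) (use s in auto)
  then obtain u where u: "s \<le> u" "u \<le> t" "N u = y"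
    using IVT2'[of N t y s] s y by auto
  then have "s < u" "u < t"
    using s y by (auto simp: less_le)
  have "N v < real (m * k)" if "u \<le> v" "v < t" for v
    using last[of v] that \<open>s < u\<close> s(1) by (auto simp: A_def not_le[symmetric])
  then have "N u \<le> N t"
    using unsaturated_backlog_nondecreasing[OF dyn rate arr] \<open>u < t\<close> \<open>s < u\<close> s by simp
  then show False
    using u y by simp
qed

lemma filterlim_affine_at_top:
  fixes a b c :: real
  assumes "0 < a"
  shows "filterlim (\<lambda>t. b + a * (t - c)) at_top at_top"
proof -
  have "filterlim (\<lambda>t. t - c) at_top at_top"
    using filterlim_tendsto_add_at_top[OF tendsto_const[of "- c"] filterlim_ident] by simp
  then show ?thesis
    using assms
    by (intro filterlim_tendsto_add_at_top[OF tendsto_const]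
        filterlim_tendsto_pos_mult_at_top[OF tendsto_const])
qed

lemma saturated_churn_ledger_affine:
  assumes sat: "\<And>t. t\<^sub>0 \<le> t \<Longrightarrow> real (m * k) \<le> N t" and "t\<^sub>0 \<le> t"
  shows "churn_ledger k m d \<rho> \<mu> c L\<^sub>0 t\<^sub>0 N t
    = L\<^sub>0 + c * ((1 - \<rho>) * (d * (\<mu> * real (m * k)))) * (t - t\<^sub>0)"
proof -
  have "integral {t\<^sub>0..t} (\<lambda>s. c * abandonment_rate k m d \<rho> \<mu> (N s))
      = integral {t\<^sub>0..t} (\<lambda>s. c * ((1 - \<rho>) * (d * (\<mu> * real (m * k)))))"
    by (rule integral_cong) (simp add: abandonment_rate_def min_absorb2 sat del: of_nat_mult)
  then show ?thesis
    using \<open>t\<^sub>0 \<le> t\<close> by (simp add: churn_ledger_def ac_simps del: of_nat_mult)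
qed

theorem proposition4:
  fixes k m :: nat
    and M :: "'w measure" and S :: "'tier \<Rightarrow> 'w \<Rightarrow> real"
    and \<mu> d :: "'tier \<Rightarrow> real" and \<rho> p\<^sub>r l r t\<^sub>0 L\<^sub>0 :: real
    and N :: "real \<Rightarrow> real" and j :: 'tier
  assumes "k \<ge> 1" and "m \<ge> 1"
    and "prob_space M"
    and "integrable M (S j)" and "AE \<omega> in M. S j \<omega> \<ge> 0"
    and "prob_space.expectation M (S j) > 0"
    and "\<mu> j = 1 / prob_space.expectation M (S j)"
    and "0 \<le> d j" and "d j < 1"
    and "0 \<le> \<rho>" and "\<rho> \<le> 1"
    and "0 \<le> p\<^sub>r" and "p\<^sub>r \<le> 1"
    and "0 \<le> r"
    and "continuous_on {t\<^sub>0..} N"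
    and "two_regime_dynamics k m (d j) \<rho> (\<mu> j) r t\<^sub>0 N"
    and "N t\<^sub>0 \<ge> real (m * k)"
  shows "((\<exists>t\<ge>t\<^sub>0. N t < real (m * k)) \<longleftrightarrow> r < effective_throughput k m (d j) \<rho> (\<mu> j)) \<and>
    (r > effective_throughput k m (d j) \<rho> (\<mu> j) \<longrightarrow>
      (\<forall>t\<ge>t\<^sub>0. \<exists>D>0. (N has_real_derivative D) (at t within {t\<^sub>0..})) \<and>
      (\<forall>t\<ge>t\<^sub>0. N t \<ge> real (m * k)) \<and>
      filterlim N at_top at_top \<and>
      (0 < d j \<and> \<rho> < 1 \<and> 0 < p\<^sub>r * l \<longrightarrow>
        filterlim (churn_ledger k m (d j) \<rho> (\<mu> j) (p\<^sub>r * l) L\<^sub>0 t\<^sub>0 N) at_top at_top))"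
proof -
  define \<theta> where "\<theta> = effective_throughput k m (d j) \<rho> (\<mu> j)"
  note dyn = \<open>two_regime_dynamics k m (d j) \<rho> (\<mu> j) r t\<^sub>0 N\<close>
  have "0 < \<mu> j"
    using assms by simp
  then have rate: "0 < effective_service_rate (d j) \<rho> (\<mu> j)"
    using assms by (intro effective_service_rate_pos) auto
  have sat: "real (m * k) \<le> N t" if "\<theta> \<le> r" "t\<^sub>0 \<le> t" for t
    using stays_saturated[OF dyn rate _ \<open>continuous_on {t\<^sub>0..} N\<close> \<open>real (m * k) \<le> N t\<^sub>0\<close>] that
    by (simp add: \<theta>_def)
  have "(\<exists>t\<ge>t\<^sub>0. N t < real (m * k)) \<longleftrightarrow> r < \<theta>"
    using drains_if_arrival_below_throughput[OF dyn] sat unfolding \<theta>_def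
    by (meson not_less)
  moreover have
    "(\<forall>t\<ge>t\<^sub>0. \<exists>D>0. (N has_real_derivative D) (at t within {t\<^sub>0..})) \<and>
      (\<forall>t\<ge>t\<^sub>0. N t \<ge> real (m * k)) \<and>
      filterlim N at_top at_top \<and>
      (0 < d j \<and> \<rho> < 1 \<and> 0 < p\<^sub>r * l \<longrightarrow>
        filterlim (churn_ledger k m (d j) \<rho> (\<mu> j) (p\<^sub>r * l) L\<^sub>0 t\<^sub>0 N) at_top at_top)"
    if "\<theta> < r"
  proof (intro conjI impI allI)
    have sat': "real (m * k) \<le> N t" if "t\<^sub>0 \<le> t" for t
      using sat \<open>\<theta> < r\<close> that by simp
    have affine: "N t = N t\<^sub>0 + (r - \<theta>) * (t - t\<^sub>0)" if "t\<^sub>0 \<le> t" for t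
      using saturated_backlog_affine[OF dyn sat' that] by (simp add: \<theta>_def)
    show "real (m * k) \<le> N t" if "t\<^sub>0 \<le> t" for t
      using sat' that .
    show "\<exists>D>0. (N has_real_derivative D) (at t within {t\<^sub>0..})" if "t\<^sub>0 \<le> t" for t
    proof (intro exI conjI)
      show "0 < r - \<theta>"
        using \<open>\<theta> < r\<close> by simp
      have "((\<lambda>t. N t\<^sub>0 + (r - \<theta>) * (t - t\<^sub>0)) has_real_derivative r - \<theta>) (at t within {t\<^sub>0..})"
        by (auto intro!: derivative_eq_intros)
      then show "(N has_real_derivative r - \<theta>) (at t within {t\<^sub>0..})"
        by (rule has_field_derivative_transform_within[where d = 1])
          (use that in \<open>auto simp flip: affine\<close>)
    qed
    have "filterlim (\<lambda>t. N t\<^sub>0 + (r - \<theta>) * (t - t\<^sub>0)) at_top at_top"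
      using \<open>\<theta> < r\<close> by (intro filterlim_affine_at_top) simp
    moreover have "\<forall>\<^sub>F t in at_top. N t\<^sub>0 + (r - \<theta>) * (t - t\<^sub>0) = N t"
      using eventually_ge_at_top[of t\<^sub>0] by eventually_elim (simp flip: affine)
    ultimately show "filterlim N at_top at_top"
      by (simp only: filterlim_cong[OF refl refl])
    assume charged: "0 < d j \<and> \<rho> < 1 \<and> 0 < p\<^sub>r * l"
    define \<kappa> where "\<kappa> = p\<^sub>r * l * ((1 - \<rho>) * (d j * (\<mu> j * real (m * k))))"
    have "0 < m * k"
      using assms by simp
    then have "0 < (1 - \<rho>) * (d j * (\<mu> j * real (m * k)))"
      using charged \<open>0 < \<mu> j\<close> by (intro mult_pos_pos) auto
    then have "0 < \<kappa>"
      using charged by (simp only: \<kappa>_def mult_pos_pos)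
    then have "filterlim (\<lambda>t. L\<^sub>0 + \<kappa> * (t - t\<^sub>0)) at_top at_top"
      by (rule filterlim_affine_at_top)
    moreover have "\<forall>\<^sub>F t in at_top.
        L\<^sub>0 + \<kappa> * (t - t\<^sub>0) = churn_ledger k m (d j) \<rho> (\<mu> j) (p\<^sub>r * l) L\<^sub>0 t\<^sub>0 N t"
      using eventually_ge_at_top[of t\<^sub>0]
      by eventually_elim (simp only: saturated_churn_ledger_affine[OF sat'] \<kappa>_def)
    ultimately show
      "filterlim (churn_ledger k m (d j) \<rho> (\<mu> j) (p\<^sub>r * l) L\<^sub>0 t\<^sub>0 N) at_top at_top"
      by (simp only: filterlim_cong[OF refl refl])
  qed
  ultimately show ?thesis
    unfolding \<theta>_def by blast
qed

end
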